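(* Let $K\subset\mathbb{C}$ be non-polar, compact and polynomially convex, and let $(q_k)_{k\in\mathbb{N}}$ be a sequence of complex polynomials with degrees $n_k=\deg q_k\to\infty$. If $(q_k)_{k\in\mathbb{N}}$ is $K$-regular, then the sequence of derivatives $(q_k')_{k\in\mathbb{N}}$ is $K$-regular. If $(q_k)_{k\in\mathbb{N}}$ centers on $K$, then the sequence of derivatives $(q_k')_{k\in\mathbb{N}}$ centers on $K$.
   Context: $\mathbb{D}(R)=\{z\in\mathbb{C}:|z|<R\}$. Polynomially convex (full) for a compact $K\subset\mathbb{C}$ means that $\Omega:=\mathbb{C}\setminus K$ is connected. For $K$ non-polar, $\omega_K$ is the equilibrium measure of $K$, i.e. the unique Borel probability measure on $K$ maximizing the energy $I(\mu)=\iint\log|z-w|\,d\mu(w)\,d\mu(z)$, and $g_\Omega(z)=\int\log|z-w|\,d\omega_K(w)-I(\omega_K)$ is the Green's function of $\Omega$ with pole at $\infty$. All sequences of polynomials considered have degrees tending to infinity, so finitely many terms of degree too small for the expressions below to make sense are disregarded. Centering: a sequence $(q_k)_k$ of polynomials centers on a non-empty compact set $C\subset\mathbb{C}$ if there exist $N\in\mathbb{N}$ and $R>0$ such that (1) $q_k^{-1}(\{0\})\subset\mathbb{D}(R)$ for all $k\ge N$; and (2) for every closed set $L\subset\mathbb{C}$ with $L\cap C=\emptyset$ there exists $M=M(L)>0$ such that for all $k\ge N$ the number of zeros of $q_k$ in $L$, counted with multiplicity, is at most $M$. $K$-regularity: a sequence $(q_k)_k$ of polynomials of degrees $n_k$ is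 $K$-regular if for some $R>0$ (taken large enough that $K\subset\mathbb{D}(R)$) one has $\lim_{k\to\infty}\frac{1}{n_k}\log|q_k(z)|=g_\Omega(z)$ uniformly on $\mathbb{C}\setminus\mathbb{D}(R)$. For the sequence $(q_k')_k$ the normalizing degree is $n_k-1$. *)

theory Defs
  imports "HOL-Probability.Probability" "HOL-Computational_Algebra.Computational_Algebra"
begin

text \<open>The logarithm with the convention \<open>log 0 = -\<infinity>\<close>; the library's \<open>ln\<close> has \<open>ln 0 = 0\<close>.\<close>

definition elog :: "real \<Rightarrow> ereal" where
  "elog x = (if 0 < x then ereal (ln x) else - \<infinity>)"

text \<open>
  The Lebesgue integral of an extended-real function as the difference of the integrals of its
  positive and negative parts (\<open>e2ennreal\<close> sends negative numbers to \<open>0\<close>). It is only used for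
  functions that are bounded above on the support of a finite measure, so the first term is
  finite and the value lies in \<open>[-\<infinity>, \<infinity>)\<close>.
\<close>

definition ereal_integral :: "'a measure \<Rightarrow> ('a \<Rightarrow> ereal) \<Rightarrow> ereal" where
  "ereal_integral M f =
     enn2ereal (\<integral>\<^sup>+ x. e2ennreal (f x) \<partial>M) - enn2ereal (\<integral>\<^sup>+ x. e2ennreal (- f x) \<partial>M)"

definition log_potential :: "complex measure \<Rightarrow> complex \<Rightarrow> ereal" where
  "log_potential \<mu> z = ereal_integral \<mu> (\<lambda>w. elog (cmod (z - w)))"

definition log_energy :: "complex measure \<Rightarrow> ereal" where
  "log_energy \<mu> = ereal_integral \<mu> (log_potential \<mu>)"

definition borel_prob_on :: "complex set \<Rightarrow> complex measure \<Rightarrow> bool" where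
  "borel_prob_on K \<mu> \<longleftrightarrow> sets \<mu> = sets borel \<and> prob_space \<mu> \<and> emeasure \<mu> (- K) = 0"

text \<open>
  Whether the energy is \<open>-\<infinity>\<close> is invariant under scaling of the measure, so it is enough to
  test probability measures instead of all nonzero finite measures with compact support in \<open>E\<close>.
\<close>

definition polar :: "complex set \<Rightarrow> bool" where
  "polar E \<longleftrightarrow>
     (\<forall>C \<mu>. compact C \<and> C \<subseteq> E \<and> borel_prob_on C \<mu> \<longrightarrow> log_energy \<mu> = - \<infinity>)"

definition polynomially_convex :: "complex set \<Rightarrow> bool" where
  "polynomially_convex K \<longleftrightarrow> connected (- K)"

text \<open>
  The sign convention has \<open>log |z - w|\<close> rather than its negative in the energy, so the
  equilibrium measure maximizes. It exists and is unique for compact non-polar \<open>K\<close>.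
\<close>

definition equilibrium_measure :: "complex set \<Rightarrow> complex measure" where
  "equilibrium_measure K =
     (THE \<omega>. borel_prob_on K \<omega> \<and> (\<forall>\<mu>. borel_prob_on K \<mu> \<longrightarrow> log_energy \<mu> \<le> log_energy \<omega>))"

text \<open>The Green's function of \<open>- K\<close> with pole at infinity; it is finite outside \<open>K\<close>.\<close>

definition green :: "complex set \<Rightarrow> complex \<Rightarrow> ereal" where
  "green K z = log_potential (equilibrium_measure K) z - log_energy (equilibrium_measure K)"

text \<open>
  Uniform convergence is spelled out since \<open>ereal\<close> is not a metric space. As
  \<open>\<bar>-\<infinity> - x\<bar> = \<infinity>\<close> for every \<open>x\<close>, the inequality forces \<open>q k\<close> to have no zeros \<open>z\<close>
  with \<open>cmod z \<ge> R\<close>.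
\<close>

definition K_regular :: "complex set \<Rightarrow> (nat \<Rightarrow> complex poly) \<Rightarrow> bool" where
  "K_regular K q \<longleftrightarrow>
     (\<exists>R>0. K \<subseteq> ball 0 R \<and>
        (\<forall>\<epsilon>>0. \<forall>\<^sub>F k in sequentially. \<forall>z \<in> - ball 0 R.
           \<bar>elog (cmod (poly (q k) z)) / ereal (real (degree (q k))) - green K z\<bar> < ereal \<epsilon>))"

definition centers_on :: "(nat \<Rightarrow> complex poly) \<Rightarrow> complex set \<Rightarrow> bool" where
  "centers_on q C \<longleftrightarrow> compact C \<and> C \<noteq> {} \<and>
     (\<exists>N R. R > 0 \<and>
        (\<forall>k\<ge>N. {z. poly (q k) z = 0} \<subseteq> ball 0 R) \<and>
        (\<forall>L. closed L \<and> L \<inter> C = {} \<longrightarrow>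
           (\<exists>M>0. \<forall>k\<ge>N. size {#z \<in># proots (q k). z \<in> L#} \<le> M)))"

end

theory Submission
  imports Defs "HOL-Complex_Analysis.Complex_Analysis" "HOL-Real_Asymp.Real_Asymp"
begin

text \<open>
  If all roots \<open>w\<close> of \<open>p\<close> lie in a disc around \<open>0\<close> and \<open>z\<close> lies outside it, then every
  \<open>z / (z - w)\<close> has real part at least \<open>1 / 2\<close>, so \<open>z p'(z) / p(z)\<close> is comparable to \<open>deg p\<close>.
  Thus passing to the derivative changes \<open>log |q\<^sub>k| / n\<^sub>k\<close> only by \<open>O(log n\<^sub>k / n\<^sub>k)\<close> near
  infinity.

  For the centering, let \<open>p\<^sub>k\<close> be the monic polynomial whose roots are the boundedly many roots of
  \<open>q\<^sub>k\<close> away from \<open>K\<close>. On a connected bounded neighbourhood, away from \<open>K\<close>, of the given closed set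
  and of a point near infinity, the functions \<open>p\<^sub>k q\<^sub>k' / (n\<^sub>k q\<^sub>k)\<close> are uniformly bounded,
  and at the point near infinity they are bounded away from \<open>0\<close>. A normal family argument bounds
  their number of zeros.
\<close>

section \<open>Polynomials as products over multisets of roots\<close>

definition root_poly :: "complex multiset \<Rightarrow> complex poly" where
  "root_poly A = (\<Prod>w\<in>#A. [:- w, 1:])"

lemma root_poly_empty [simp]: "root_poly {#} = 1"
  and root_poly_add_mset [simp]: "root_poly (add_mset w A) = [:- w, 1:] * root_poly A"
  and root_poly_union: "root_poly (A + B) = root_poly A * root_poly B"
  by (simp_all add: root_poly_def)

lemma poly_root_poly_eq_0_iff: "poly (root_poly A) z = 0 \<longleftrightarrow> z \<in># A"
  by (induction A) auto

lemma smult_root_poly_proots: "smult (lead_coeff p) (root_poly (proots p)) = p"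
  using complex_poly_decompose_multiset[of p] by (simp add: root_poly_def)

text \<open>Sorting the roots by location splits a polynomial into two factors with multiplicities
  kept. This is used for the roots of \<open>q i\<close> near and away from \<open>K\<close>, and
  for those of its derivative in and outside the set under consideration.\<close>

lemma smult_root_poly_filter_proots:
  "smult (lead_coeff p)
    (root_poly {#w \<in># proots p. X w#} * root_poly {#w \<in># proots p. \<not> X w#}) = p"
  using smult_root_poly_proots[of p] by (simp flip: root_poly_union)

lemma norm_proots_less:
  assumes "{w. poly p w = 0} \<subseteq> ball 0 R" "w \<in># proots p"
  shows "norm w < R"
  using assms by (cases "p = 0") auto

lemma norm_poly_root_poly_le:
  assumes "\<And>w. w \<in># A \<Longrightarrow> norm (z - w) \<le> d" "0 \<le> d"
  shows "norm (poly (root_poly A) z) \<le> d ^ size A"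
  using assms
proof (induction A)
  case (add w A)
  have "norm (z - w) * norm (poly (root_poly A) z) \<le> d * d ^ size A"
    using add by (intro mult_mono) auto
  then show ?case
    by (simp add: norm_mult[symmetric] algebra_simps)
qed simp

lemma norm_poly_root_poly_ge:
  assumes "\<And>w. w \<in># A \<Longrightarrow> d \<le> norm (z - w)" "0 \<le> d"
  shows "d ^ size A \<le> norm (poly (root_poly A) z)"
  using assms
proof (induction A)
  case (add w A)
  have "d * d ^ size A \<le> norm (z - w) * norm (poly (root_poly A) z)"
    using add by (intro mult_mono) auto
  then show ?case
    by (simp add: norm_mult[symmetric] algebra_simps)
qed simp

lemma poly_pderiv_root_poly:
  assumes "z \<notin># A"
  shows "poly (pderiv (root_poly A)) z = poly (root_poly A) z * (\<Sum>w\<in>#A. 1 / (z - w))"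
  using assms
proof (induction A)
  case (add w A)
  then have "z \<noteq> w" by auto
  then show ?case
    using add unfolding root_poly_add_mset pderiv_mult
    by (simp add: pderiv_pCons field_simps del: mult_pCons_left mult_pCons_right)
qed simp

lemma norm_sum_mset_le:
  fixes f :: "'a \<Rightarrow> 'b :: real_normed_vector"
  assumes "\<And>w. w \<in># A \<Longrightarrow> norm (f w) \<le> b"
  shows "norm (\<Sum>w\<in>#A. f w) \<le> real (size A) * b"
  using assms
proof (induction A)
  case (add w A)
  then have "norm (f w) + norm (\<Sum>w\<in>#A. f w) \<le> b + real (size A) * b"
    by (intro add_mono) auto
  then show ?case
    using norm_triangle_ineq[of "f w" "\<Sum>w\<in>#A. f w"] by (simp add: algebra_simps)
qed simp

lemma Re_sum_mset_ge:
  assumes "\<And>w. w \<in># A \<Longrightarrow> b \<le> Re (f w)"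
  shows "real (size A) * b \<le> Re (\<Sum>w\<in>#A. f w)"
  using assms
proof (induction A)
  case (add w A)
  then have "b + real (size A) * b \<le> Re (f w) + Re (\<Sum>w\<in>#A. f w)"
    by (intro add_mono) auto
  then show ?case
    by (simp add: algebra_simps)
qed simp

section \<open>The derivative outside a disc that contains the roots\<close>

text \<open>With t = w / z the quotient is 1 / (1 - t), and this Moebius map sends the closed unit
  disc without 1 into the half-plane Re >= 1/2.\<close>

lemma Re_divide_diff_ge_half:
  assumes "norm w \<le> norm z" "w \<noteq> z"
  shows "1 / 2 \<le> Re (z / (z - w))"
proof -
  have pos: "0 < (Re (z - w))\<^sup>2 + (Im (z - w))\<^sup>2"
    using assms by (auto simp: sum_power2_gt_zero_iff complex_eq_iff)
  have "(norm w)\<^sup>2 \<le> (norm z)\<^sup>2"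
    using assms by simp
  then have "(Re w)\<^sup>2 + (Im w)\<^sup>2 \<le> (Re z)\<^sup>2 + (Im z)\<^sup>2"
    by (simp add: cmod_power2)
  \<comment> \<open>With u = z - w, the inequality |z - u|^2 <= |z|^2 expands to |u|^2 <= 2 Re (z *
    cnj u).\<close>
  then have "(Re (z - w))\<^sup>2 + (Im (z - w))\<^sup>2 \<le> 2 * (Re z * Re (z - w) + Im z * Im (z - w))"
    by (simp add: power2_eq_square algebra_simps)
  then show ?thesis
    using pos by (simp add: Re_divide field_simps)
qed

lemma poly_pderiv_eq_sum_proots:
  fixes p :: "complex poly"
  assumes "poly p z \<noteq> 0"
  shows "poly (pderiv p) z = poly p z * (\<Sum>w\<in>#proots p. 1 / (z - w))"
proof -
  have z: "z \<notin># proots p"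
    using assms by (cases "p = 0") auto
  have "poly (pderiv p) z = lead_coeff p * poly (pderiv (root_poly (proots p))) z"
    by (subst (1) smult_root_poly_proots[symmetric]) (simp add: pderiv_smult)
  also have "\<dots> = poly (smult (lead_coeff p) (root_poly (proots p))) z * (\<Sum>w\<in>#proots p. 1 / (z - w))"
    using poly_pderiv_root_poly[OF z] by simp
  finally show ?thesis
    by (simp only: smult_root_poly_proots)
qed

text \<open>The quotient z p'(z) / p(z) is the sum of z / (z - w) over the roots. All these terms
  have real part at least 1/2, so they cannot cancel.\<close>

lemma norm_pderiv_ge_outside_roots:
  fixes p :: "complex poly"
  assumes "{w. poly p w = 0} \<subseteq> ball 0 R" "R \<le> norm z"
  shows "real (degree p) / 2 * norm (poly p z) \<le> norm z * norm (poly (pderiv p) z)"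
proof -
  have nz: "poly p z \<noteq> 0"
    using assms by (auto simp: subset_iff)
  have "real (degree p) * (1 / 2) \<le> Re (\<Sum>w\<in>#proots p. z / (z - w))"
    unfolding size_proots_complex[symmetric]
  proof (intro Re_sum_mset_ge Re_divide_diff_ge_half)
    fix w assume "w \<in># proots p"
    then have "norm w < R"
      using norm_proots_less[OF assms(1)] by simp
    then show "norm w \<le> norm z" "w \<noteq> z"
      using assms(2) by auto
  qed
  also have "\<dots> \<le> norm (\<Sum>w\<in>#proots p. z / (z - w))"
    by (rule complex_Re_le_cmod)
  also have "(\<Sum>w\<in>#proots p. z / (z - w)) = z * (\<Sum>w\<in>#proots p. 1 / (z - w))"
    by (simp add: sum_mset_distrib_left)
  finally have "real (degree p) * (1 / 2) * norm (poly p z)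
      \<le> norm (z * (\<Sum>w\<in>#proots p. 1 / (z - w))) * norm (poly p z)"
    by (rule mult_right_mono) simp
  then show ?thesis
    by (simp add: poly_pderiv_eq_sum_proots[OF nz] norm_mult mult_ac)
qed

text \<open>Doubling the radius gives |z - w| >= |z| / 2 for every root w, which bounds each term of
  the logarithmic derivative by 2 / |z|.\<close>

lemma norm_pderiv_le_outside_roots:
  fixes p :: "complex poly"
  assumes "{w. poly p w = 0} \<subseteq> ball 0 R" "0 < R" "2 * R \<le> norm z"
  shows "norm z * norm (poly (pderiv p) z) \<le> 2 * real (degree p) * norm (poly p z)"
proof -
  have nz: "poly p z \<noteq> 0"
    using assms by (auto simp: subset_iff)
  have "norm (\<Sum>w\<in>#proots p. 1 / (z - w)) \<le> real (degree p) * (2 / norm z)"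
    unfolding size_proots_complex[symmetric]
  proof (intro norm_sum_mset_le)
    fix w assume "w \<in># proots p"
    then have "norm w < R"
      using norm_proots_less[OF assms(1)] by simp
    then have "norm z / 2 \<le> norm (z - w)"
      using assms(3) norm_triangle_ineq2[of z w] by linarith
    moreover have "0 < norm z"
      using assms(2,3) by linarith
    ultimately have "1 / norm (z - w) \<le> 1 / (norm z / 2)"
      by (intro frac_le) auto
    then show "norm (1 / (z - w)) \<le> 2 / norm z"
      by (simp add: norm_divide)
  qed
  then have "norm (\<Sum>w\<in>#proots p. 1 / (z - w)) * (norm z * norm (poly p z))
      \<le> real (degree p) * (2 / norm z) * (norm z * norm (poly p z))"
    by (rule mult_right_mono) simp
  also have "\<dots> = 2 * real (degree p) * norm (poly p z)"
    using assms(2,3) by auto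
  finally show ?thesis
    by (simp add: poly_pderiv_eq_sum_proots[OF nz] norm_mult mult_ac)
qed

text \<open>A case of the Gauss-Lucas theorem: by the lower bound, a zero of p' outside the disc
  would also be a zero of p.\<close>

lemma roots_pderiv_subset_ball:
  fixes p :: "complex poly"
  assumes "{w. poly p w = 0} \<subseteq> ball 0 R" "0 < degree p"
  shows "{w. poly (pderiv p) w = 0} \<subseteq> ball 0 R"
proof
  fix z assume z: "z \<in> {w. poly (pderiv p) w = 0}"
  show "z \<in> ball 0 R"
  proof (rule ccontr)
    assume "z \<notin> ball 0 R"
    then have "R \<le> norm z" by simp
    with norm_pderiv_ge_outside_roots[OF assms(1) this] z assms(2) have "poly p z = 0"
      by (simp add: mult_le_0_iff)
    then show False
      using assms(1) \<open>z \<notin> ball 0 R\<close> by auto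
  qed
qed

section \<open>Counting zeros by a normal family argument\<close>

text \<open>A Schwarz-type estimate. Each factor u - w has modulus at least 3r on the circle of
  radius 4r, so the maximum principle bounds \<open>G\<close> by C / (3r)^n inside, where n =
  \<open>size A\<close>. On the small ball each factor is at most 2r, so every zero gains a factor
  2/3.\<close>

lemma norm_root_poly_mult_le:
  assumes G: "G holomorphic_on ball a s" "4 * r < s"
    and r: "0 < r" and C: "\<And>z. norm (z - a) = 4 * r \<Longrightarrow> norm (poly (root_poly A) z * G z) \<le> C"
    and A: "set_mset A \<subseteq> ball a r" and z: "z \<in> ball a r"
  shows "norm (poly (root_poly A) z * G z) \<le> C * (2 / 3) ^ size A"
proof -
  have "norm (G z) \<le> C / (3 * r) ^ size A"
  proof (rule maximum_modulus_frontier[where f = G and S = "cball a (4 * r)"])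
    show "G holomorphic_on interior (cball a (4 * r))" "continuous_on (closure (cball a (4 * r))) G"
      using G by (auto intro!: holomorphic_on_imp_continuous_on intro: holomorphic_on_subset)
    show "norm (G u) \<le> C / (3 * r) ^ size A" if "u \<in> frontier (cball a (4 * r))" for u
    proof -
      from that have u: "norm (u - a) = 4 * r"
        using r by (simp add: dist_norm norm_minus_commute)
      have "(3 * r) ^ size A \<le> norm (poly (root_poly A) u)"
      proof (rule norm_poly_root_poly_ge)
        fix w assume "w \<in># A"
        then have "norm (w - a) < r"
          using A by (auto simp: dist_norm norm_minus_commute)
        then show "3 * r \<le> norm (u - w)"
          using u norm_triangle_ineq2[of "u - a" "w - a"] by simp
      qed (use r in simp)
      then have "(3 * r) ^ size A * norm (G u) \<le> norm (poly (root_poly A) u * G u)"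
        by (simp add: norm_mult mult_right_mono)
      also have "\<dots> \<le> C"
        by (rule C[OF u])
      finally show ?thesis
        using r by (simp add: field_simps)
    qed
  qed (use z r in auto)
  moreover have "norm (poly (root_poly A) z) \<le> (2 * r) ^ size A"
  proof (rule norm_poly_root_poly_le)
    fix w assume "w \<in># A"
    then have "norm (w - a) < r" "norm (z - a) < r"
      using A z by (auto simp: dist_norm norm_minus_commute)
    then show "norm (z - w) \<le> 2 * r"
      using norm_triangle_ineq4[of "z - a" "w - a"] by simp
  qed (use r in simp)
  ultimately have "norm (poly (root_poly A) z) * norm (G z) \<le> (2 * r) ^ size A * (C / (3 * r) ^ size A)"
    using r by (intro mult_mono) auto
  also have "\<dots> = C * (2 / 3) ^ size A"
    using r by (simp add: power_mult_distrib power_divide)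
  finally show ?thesis
    by (simp add: norm_mult)
qed

text \<open>
  If the counts were unbounded, they would be unbounded on a single small ball; there the functions
  would tend to zero, so by Montel and the identity theorem they would tend to zero at \<open>z0\<close>.
\<close>

lemma bounded_zero_count:
  fixes A :: "'i \<Rightarrow> complex multiset" and G :: "'i \<Rightarrow> complex \<Rightarrow> complex"
  assumes U: "open U" "connected U" and L: "compact L" "L \<subseteq> U"
    and G: "\<And>i. i \<in> I \<Longrightarrow> G i holomorphic_on U"
    and C: "\<And>i z. \<lbrakk>i \<in> I; z \<in> U\<rbrakk> \<Longrightarrow> norm (poly (root_poly (A i)) z * G i z) \<le> C"
    and z0: "z0 \<in> U" and c: "0 < c"
    and low: "\<And>i. i \<in> I \<Longrightarrow> c \<le> norm (poly (root_poly (A i)) z0 * G i z0)"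
    and A: "\<And>i. i \<in> I \<Longrightarrow> set_mset (A i) \<subseteq> L"
  shows "\<exists>M. \<forall>i\<in>I. size (A i) \<le> M"
proof -
  define F where "F i z = poly (root_poly (A i)) z * G i z" for i z
  have holF: "F i holomorphic_on U" if "i \<in> I" for i
    unfolding F_def using G[OF that] by (intro holomorphic_intros)
  \<comment> \<open>The radius 5r leaves room in \<open>U\<close> for the closed ball of radius 4r
    on which the maximum principle is applied.\<close>
  have local: "\<exists>M. \<forall>i\<in>I. size {#w \<in># A i. w \<in> ball a r#} \<le> M"
    if r: "0 < r" and a: "ball a (5 * r) \<subseteq> U" for a r
  proof (rule ccontr)
    assume "\<nexists>M. \<forall>i\<in>I. size {#w \<in># A i. w \<in> ball a r#} \<le> M"
    then have "\<forall>m. \<exists>i. i \<in> I \<and> m < size {#w \<in># A i. w \<in> ball a r#}"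
      by (meson not_le)
    then obtain j where j: "\<And>m. j m \<in> I" "\<And>m. m < size {#w \<in># A (j m). w \<in> ball a r#}"
      by metis
    obtain g \<rho> where g: "g holomorphic_on U" "strict_mono (\<rho> :: nat \<Rightarrow> nat)"
      and lim: "\<And>x. x \<in> U \<Longrightarrow> (\<lambda>n. F (j (\<rho> n)) x) \<longlonglongrightarrow> g x"
    proof (rule Montel[OF U(1), of "F ` I" "\<lambda>m. F (j m)"])
      show "\<exists>B. \<forall>h\<in>F ` I. \<forall>z\<in>K. norm (h z) \<le> B" if "K \<subseteq> U" for K
        using C that by (auto simp: F_def)
    qed (use holF j in auto)
    have "g z = 0" if z: "z \<in> ball a r" for z
    proof -
      have "z \<in> U"
        using z a r by (auto simp: subset_iff)
      have bound: "norm (F (j m) z) \<le> C * (2 / 3) ^ m" for m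
      proof -
        \<comment> \<open>Only the roots in the ball, more than \<open>m\<close> of them, contribute
          factors 2/3; the roots in \<open>D\<close> are moved into the holomorphic
          cofactor.\<close>
        define B where "B = {#w \<in># A (j m). w \<in> ball a r#}"
        define D where "D = {#w \<in># A (j m). w \<notin> ball a r#}"
        have AB: "A (j m) = B + D"
          by (simp add: B_def D_def)
        have F_eq: "F (j m) u = poly (root_poly B) u * (poly (root_poly D) u * G (j m) u)" for u
          by (simp add: F_def AB root_poly_union mult_ac)
        have "norm (F (j m) z) \<le> C * (2 / 3) ^ size B"
          unfolding F_eq
        proof (rule norm_root_poly_mult_le[where s = "5 * r" and a = a and r = r])
          show "(\<lambda>u. poly (root_poly D) u * G (j m) u) holomorphic_on ball a (5 * r)"
            by (intro holomorphic_intros holomorphic_on_subset[OF G[OF j(1)] a])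
          show "norm (poly (root_poly B) u * (poly (root_poly D) u * G (j m) u)) \<le> C"
            if "norm (u - a) = 4 * r" for u
          proof -
            have "u \<in> U"
              using that a r by (auto simp: subset_iff dist_norm norm_minus_commute)
            then show ?thesis
              using C[OF j(1), of u m] by (simp flip: F_eq add: F_def)
          qed
        qed (use r z in \<open>auto simp: B_def\<close>)
        also have "\<dots> \<le> C * (2 / 3) ^ m"
        proof (rule mult_left_mono)
          show "(2 / 3 :: real) ^ size B \<le> (2 / 3) ^ m"
            using j(2)[of m] by (intro power_decreasing) (auto simp: B_def)
          show "0 \<le> C"
            using C[OF j(1) \<open>z \<in> U\<close>] norm_ge_zero order_trans by blast
        qed
        finally show ?thesis .
      qed
      have "(\<lambda>m. F (j m) z) \<longlonglongrightarrow> 0"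
      proof (rule Lim_null_comparison)
        show "\<forall>\<^sub>F m in sequentially. norm (F (j m) z) \<le> C * (2 / 3) ^ m"
          using bound by simp
        show "(\<lambda>m. C * (2 / 3) ^ m) \<longlonglongrightarrow> 0"
          by real_asymp
      qed
      then have "(\<lambda>n. F (j (\<rho> n)) z) \<longlonglongrightarrow> 0"
        using LIMSEQ_subseq_LIMSEQ[OF _ g(2)] by (simp add: o_def)
      with lim[OF \<open>z \<in> U\<close>] show "g z = 0"
        using LIMSEQ_unique by blast
    qed
    moreover have "ball a r \<subseteq> U"
      using a r by (auto simp: subset_iff)
    moreover have "a islimpt ball a r" "a \<in> U"
      using r calculation(2) by (auto simp: islimpt_ball)
    \<comment> \<open>Identity theorem: vanishing on the ball spreads over the connected set
      \<open>U\<close> as far as \<open>z0\<close>.\<close>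
    ultimately have "g z0 = 0"
      using analytic_continuation[OF g(1) U] z0 by blast
    then have "(\<lambda>n. norm (F (j (\<rho> n)) z0)) \<longlonglongrightarrow> 0"
      using tendsto_norm[OF lim[OF z0]] by simp
    then have "c \<le> 0"
      by (rule LIMSEQ_le_const) (use low j in \<open>auto simp: F_def\<close>)
    with c show False
      by simp
  qed
  have "\<forall>a\<in>L. \<exists>r>0. ball a (5 * r) \<subseteq> U"
  proof
    fix a assume "a \<in> L"
    then obtain e where "0 < e" "ball a e \<subseteq> U"
      using U(1) L(2) openE by blast
    then show "\<exists>r>0. ball a (5 * r) \<subseteq> U"
      by (intro exI[of _ "e / 5"]) auto
  qed
  then obtain r where r: "\<And>a. a \<in> L \<Longrightarrow> 0 < r a" "\<And>a. a \<in> L \<Longrightarrow> ball a (5 * r a) \<subseteq> U"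
    by metis
  have "L \<subseteq> (\<Union>a\<in>L. ball a (r a))"
    using r(1) by force
  then obtain T where T: "T \<subseteq> L" "finite T" "L \<subseteq> (\<Union>a\<in>T. ball a (r a))"
    using L(1) by (meson compactE_image open_ball)
  have "\<forall>a\<in>T. \<exists>M. \<forall>i\<in>I. size {#w \<in># A i. w \<in> ball a (r a)#} \<le> M"
    using local r T(1) by (meson subset_iff)
  then obtain M where M: "\<And>a i. a \<in> T \<Longrightarrow> i \<in> I \<Longrightarrow> size {#w \<in># A i. w \<in> ball a (r a)#} \<le> M a"
    by metis
  \<comment> \<open>The balls may overlap, so a root can be counted several times; it is counted at
    least once, which gives an inequality.\<close>
  have cover: "size X \<le> (\<Sum>a\<in>T. size {#w \<in># X. w \<in> ball a (r a)#})" if "set_mset X \<subseteq> L" for X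
    using that
  proof (induction X)
    case (add x X)
    then obtain b where b: "b \<in> T" "x \<in> ball b (r b)"
      using T(3) by auto
    have "Suc (\<Sum>a\<in>T. size {#w \<in># X. w \<in> ball a (r a)#})
        \<le> (\<Sum>a\<in>T. (if x \<in> ball a (r a) then 1 else 0) + size {#w \<in># X. w \<in> ball a (r a)#})"
      using b T(2) member_le_sum[of b T "\<lambda>a. if x \<in> ball a (r a) then 1 else (0::nat)"]
      by (simp add: sum.distrib del: mem_ball)
    also have "\<dots> = (\<Sum>a\<in>T. size {#w \<in># add_mset x X. w \<in> ball a (r a)#})"
      by (intro sum.cong) auto
    finally show ?case
      using add by simp
  qed simp
  have "size (A i) \<le> (\<Sum>a\<in>T. M a)" if "i \<in> I" for i
    using cover[OF A[OF that]] sum_mono[of T _ M, OF M[OF _ that]] by (rule order_trans)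
  then show ?thesis
    by blast
qed

section \<open>Centering of the derivatives\<close>

text \<open>Finitely many closed balls in \<open>S\<close> cover \<open>L\<close>, and paths in
  \<open>S\<close> join their centres to one common base point. Compactness of the result gives a
  positive distance from \<open>K\<close> in the application.\<close>

lemma compact_connected_neighbourhood:
  fixes S L :: "'a :: euclidean_space set"
  assumes S: "open S" "connected S" and L: "compact L" "L \<subseteq> S" "L \<noteq> {}"
  obtains C where "compact C" "connected C" "L \<subseteq> C" "C \<subseteq> S"
proof -
  have "\<forall>a\<in>L. \<exists>r>0. cball a r \<subseteq> S"
    using S(1) L(2) open_contains_cball by blast
  then obtain r where r: "\<And>a. a \<in> L \<Longrightarrow> 0 < r a" "\<And>a. a \<in> L \<Longrightarrow> cball a (r a) \<subseteq> S"
    by metis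
  have "L \<subseteq> (\<Union>a\<in>L. ball a (r a))"
    using r(1) by force
  then obtain T where T: "T \<subseteq> L" "finite T" "L \<subseteq> (\<Union>a\<in>T. ball a (r a))"
    using L(1) by (meson compactE_image open_ball)
  obtain b where b: "b \<in> L"
    using L(3) by blast
  have "path_connected S"
    using S connected_open_path_connected by blast
  moreover have "T \<subseteq> S" "b \<in> S"
    using T(1) L(2) b by auto
  ultimately have "\<forall>a\<in>T. \<exists>p. path p \<and> path_image p \<subseteq> S \<and> pathstart p = b \<and> pathfinish p = a"
    unfolding path_connected_def by blast
  then obtain p where p: "\<And>a. a \<in> T \<Longrightarrow> path (p a) \<and> path_image (p a) \<subseteq> S \<and> pathstart (p a) = b \<and> pathfinish (p a) = a"
    by metis
  define X where "X a = path_image (p a) \<union> cball a (r a)" for a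
  have X: "compact (X a)" "connected (X a)" "b \<in> X a" "X a \<subseteq> S" if "a \<in> T" for a
  proof -
    have pa: "path (p a)" "path_image (p a) \<subseteq> S" "b \<in> path_image (p a)" "a \<in> path_image (p a)"
      using p[OF that] pathstart_in_path_image[of "p a"] pathfinish_in_path_image[of "p a"] by auto
    have ra: "0 < r a" "cball a (r a) \<subseteq> S"
      using r that T(1) by auto
    show "compact (X a)"
      using pa by (auto simp: X_def compact_path_image)
    show "connected (X a)"
      unfolding X_def by (rule connected_Un) (use pa ra in \<open>auto simp: connected_path_image\<close>)
    show "b \<in> X a" "X a \<subseteq> S"
      using pa ra by (auto simp: X_def)
  qed
  show ?thesis
  proof
    show "compact (\<Union>a\<in>T. X a)"
      using T(2) X(1) by auto
    show "connected (\<Union>a\<in>T. X a)"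
      by (rule connected_Union) (use X(2,3) in blast)+
    show "L \<subseteq> (\<Union>a\<in>T. X a)"
      using T(3) by (force simp: X_def)
    show "(\<Union>a\<in>T. X a) \<subseteq> S"
      using X(4) by auto
  qed
qed

text \<open>The logarithmic derivative is of no use here, since \<open>z\<close> may be a root.
  Induction with the product rule avoids division, and \<open>1 \<le> d\<close> allows the exponent
  \<open>size A\<close> throughout.\<close>

lemma norm_pderiv_root_poly_le:
  assumes "\<And>w. w \<in># A \<Longrightarrow> norm (z - w) \<le> d" "1 \<le> d"
  shows "norm (poly (pderiv (root_poly A)) z) \<le> real (size A) * d ^ size A"
  using assms
proof (induction A)
  case (add w A)
  have "poly (pderiv (root_poly (add_mset w A))) z
      = (z - w) * poly (pderiv (root_poly A)) z + poly (root_poly A) z"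
    unfolding root_poly_add_mset pderiv_mult
    by (simp add: pderiv_pCons algebra_simps del: mult_pCons_left mult_pCons_right)
  also have "norm \<dots> \<le> norm (z - w) * norm (poly (pderiv (root_poly A)) z) + norm (poly (root_poly A) z)"
    using norm_triangle_ineq by (metis norm_mult)
  also have "\<dots> \<le> d * (real (size A) * d ^ size A) + d ^ size A"
    using add by (intro add_mono mult_mono norm_poly_root_poly_le) auto
  also have "\<dots> \<le> d * (real (size A) * d ^ size A) + d * d ^ size A"
    using add.prems by (intro add_left_mono) simp
  finally show ?case
    by (simp add: algebra_simps)
qed simp

text \<open>Multiplying q'/q by the polynomial of the roots away from \<open>K\<close> removes all
  poles in a region around \<open>L\<close> and \<open>z0\<close>. The other roots keep a fixed
  distance from that region, so division by the degree makes the family uniformly bounded.\<close>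

lemma pderiv_root_count_bounded:
  fixes q :: "'i \<Rightarrow> complex poly"
  assumes K: "compact K" "connected (- K)"
    and roots: "\<And>i. i \<in> I \<Longrightarrow> {w. poly (q i) w = 0} \<subseteq> ball 0 R"
    and deg: "\<And>i. i \<in> I \<Longrightarrow> 0 < degree (q i)"
    and count: "\<And>W. \<lbrakk>closed W; W \<inter> K = {}\<rbrakk> \<Longrightarrow>
      \<exists>M. \<forall>i\<in>I. size {#w \<in># proots (q i). w \<in> W#} \<le> M"
    and L: "closed L" "L \<inter> K = {}"
  shows "\<exists>M. \<forall>i\<in>I. size {#w \<in># proots (pderiv (q i)). w \<in> L#} \<le> M"
proof -
  obtain R0 where R0: "\<And>x. x \<in> K \<Longrightarrow> norm x \<le> R0"
    using K(1) compact_imp_bounded bounded_iff by metis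
  define S where "S = max \<bar>R\<bar> \<bar>R0\<bar>"
  have S: "0 \<le> S" "R \<le> S" "\<And>x. x \<in> K \<Longrightarrow> norm x \<le> S"
    using R0 by (fastforce simp: S_def)+
  \<comment> \<open>This point has distance at least 1 from \<open>K\<close> and from every root of
    every \<open>q i\<close> with \<open>i \<in> I\<close>.\<close>
  define z0 :: complex where "z0 = of_real (S + 1)"
  have norm_z0: "norm z0 = S + 1"
    using S(1) by (simp only: z0_def norm_of_real)
  \<comment> \<open>The truncation makes the set compact and loses no zero of a derivative, as those
    zeros lie in \<open>ball 0 R\<close>.\<close>
  define L' where "L' = L \<inter> cball 0 S"
  have "compact (insert z0 L')"
    unfolding L'_def using L(1) by (intro compact_insert closed_Int_compact) auto
  moreover have "insert z0 L' \<subseteq> - K"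
    using L(2) S(3)[of z0] norm_z0 by (auto simp: L'_def)
  moreover have "open (- K)"
    using K(1) by (simp add: compact_imp_closed open_Compl)
  ultimately obtain C where C: "compact C" "connected C" "insert z0 L' \<subseteq> C" "C \<subseteq> - K"
    using compact_connected_neighbourhood[of "- K" "insert z0 L'"] K(2) by blast
  \<comment> \<open>Thickening both \<open>C\<close> and \<open>K\<close> by \<open>\<delta>\<close>
    then still leaves a gap larger than \<open>\<delta>\<close>.\<close>
  obtain \<delta> where \<delta>: "0 < \<delta>" "\<And>c x. \<lbrakk>c \<in> C; x \<in> K\<rbrakk> \<Longrightarrow> 4 * \<delta> \<le> dist c x"
  proof -
    have "\<exists>d>0. \<forall>c\<in>C. \<forall>x\<in>K. d \<le> dist c x"
      using C(1,4) K(1) by (intro separate_compact_closed) (auto simp: compact_imp_closed)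
    then obtain d where "0 < d" "\<forall>c\<in>C. \<forall>x\<in>K. d \<le> dist c x"
      by blast
    then show ?thesis
      by (intro that[of "d / 4"]) auto
  qed
  define U where "U = (\<Union>c\<in>C. ball c \<delta>)"
  \<comment> \<open>The complement of the open \<open>\<delta>\<close>-neighbourhood of
    \<open>K\<close> is closed and disjoint from \<open>K\<close>, so it holds boundedly many roots;
    all other roots stay away from \<open>U\<close>.\<close>
  define W where "W = - (\<Union>x\<in>K. ball x \<delta>)"
  have CU: "C \<subseteq> U"
    using \<delta>(1) by (force simp: U_def)
  have "connected (C \<union> U)"
    unfolding U_def using C(2) \<delta>(1) by (intro connected_Un_UN) fastforce+
  then have U: "open U" "connected U"
    using CU by (auto simp: U_def Un_absorb1)
  have far: "\<delta> \<le> norm (u - w)" if u: "u \<in> U" and w: "w \<notin> W" for u w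
  proof -
    obtain c x where "c \<in> C" "dist c u < \<delta>" "x \<in> K" "dist x w < \<delta>"
      using u w by (auto simp: U_def W_def)
    moreover have "dist c x \<le> dist c u + dist u w + dist x w"
      using dist_triangle[of c x u] dist_triangle[of u x w] by (simp add: dist_commute)
    ultimately show ?thesis
      using \<delta>(2)[of c x] \<delta>(1) unfolding dist_norm[of u w] by linarith
  qed
  have "closed W" "W \<inter> K = {}"
    using \<delta>(1) by (force simp: W_def)+
  then obtain M where M: "\<And>i. i \<in> I \<Longrightarrow> size {#w \<in># proots (q i). w \<in> W#} \<le> M"
    using count[of W] by blast
  obtain b where b: "\<And>c. c \<in> C \<Longrightarrow> norm c \<le> b"
    using C(1) compact_imp_bounded bounded_iff by metis
  have b0: "0 \<le> b"
    using b[of z0] C(3) norm_z0 S(1) by simp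
  \<comment> \<open>Points of \<open>U\<close> have modulus at most \<open>b + \<delta>\<close> and
    roots modulus below \<open>S\<close>, so \<open>d\<close> bounds their distances; the summand 1
    ensures \<open>1 \<le> d\<close>.\<close>
  define d where "d = b + \<delta> + S + 1"
  have d1: "1 \<le> d"
    using b0 \<delta>(1) S(1) by (simp add: d_def)
  define P where "P i = {#w \<in># proots (q i). w \<in> W#}" for i
  define Q where "Q i = {#w \<in># proots (q i). w \<notin> W#}" for i
  define A where "A i = {#w \<in># proots (pderiv (q i)). w \<in> L'#}" for i
  define B where "B i = {#w \<in># proots (pderiv (q i)). w \<notin> L'#}" for i
  define n where "n i = real (degree (q i))" for i
  define l where "l i = lead_coeff (q i)" for i
  \<comment> \<open>By q = l P Q, the function p q' / (n q) with p = P equals q' / (n l Q). Removing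
    the zeros of q' in \<open>L'\<close> from it leaves \<open>G i\<close>, whose denominator has no
    zero in \<open>U\<close>.\<close>
  define G where "G i z = lead_coeff (pderiv (q i)) * poly (root_poly (B i)) z
      / (of_real (n i) * l i * poly (root_poly (Q i)) z)" for i z
  have q_eq: "smult (l i) (root_poly (P i) * root_poly (Q i)) = q i" for i
    unfolding l_def P_def Q_def by (rule smult_root_poly_filter_proots)
  have q'_eq: "smult (lead_coeff (pderiv (q i))) (root_poly (A i) * root_poly (B i)) = pderiv (q i)" for i
    unfolding A_def B_def by (rule smult_root_poly_filter_proots)
  have F_eq: "poly (root_poly (A i)) z * G i z
      = poly (pderiv (q i)) z / (of_real (n i) * l i * poly (root_poly (Q i)) z)" for i z
    by (subst q'_eq[symmetric]) (simp add: G_def)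
  have n1: "1 \<le> n i" and l0: "l i \<noteq> 0" if "i \<in> I" for i
    using deg[OF that] by (auto simp: n_def l_def)
  have norm_root: "norm w < R" if "i \<in> I" "w \<in># proots (q i)" for i w
    using norm_proots_less[OF roots that(2)] that(1) .
  have Q_nz: "poly (root_poly (Q i)) z \<noteq> 0" if "z \<in> U" for i z
    using far[OF that, of z] \<delta>(1) by (auto simp: poly_root_poly_eq_0_iff Q_def)
  have bound: "norm (poly (root_poly (A i)) z * G i z) \<le> real M * d ^ M + d ^ M * (1 / \<delta>)"
    if i: "i \<in> I" and z: "z \<in> U" for i z
  proof -
    have zd: "norm (z - w) \<le> d" if "w \<in># P i" for w
    proof -
      obtain c where "c \<in> C" "dist c z < \<delta>"
        using z by (auto simp: U_def)
      then have "norm z \<le> b + \<delta>"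
        using b[of c] norm_triangle_ineq2[of z c] by (simp add: dist_norm norm_minus_commute)
      moreover have "norm w < R"
        using norm_root[OF i] that by (auto simp: P_def)
      ultimately show ?thesis
        using norm_triangle_ineq4[of z w] S by (simp add: d_def)
    qed
    have PM: "size (P i) \<le> M"
      using M[OF i] by (simp add: P_def)
    have dM: "d ^ size (P i) \<le> d ^ M"
      using PM d1 by (rule power_increasing)
    let ?s = "\<Sum>w\<in>#Q i. 1 / (z - w)"
    have "z \<notin># Q i"
      using Q_nz[OF z] by (simp add: poly_root_poly_eq_0_iff)
    \<comment> \<open>Product rule for P Q. Only Q is differentiated logarithmically, since P may
      vanish at \<open>z\<close>.\<close>
    then have "poly (pderiv (q i)) z = l i * poly (root_poly (Q i)) z
        * (poly (pderiv (root_poly (P i))) z + poly (root_poly (P i)) z * ?s)"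
      by (subst (1) q_eq[symmetric]) (simp add: pderiv_smult pderiv_mult poly_pderiv_root_poly algebra_simps)
    then have "poly (root_poly (A i)) z * G i z
        = (poly (pderiv (root_poly (P i))) z + poly (root_poly (P i)) z * ?s) / of_real (n i)"
      unfolding F_eq using Q_nz[OF z] l0[OF i] by simp
    also have "norm \<dots> \<le> (real M * d ^ M + d ^ M * (n i * (1 / \<delta>))) / n i"
    proof -
      have "norm (poly (pderiv (root_poly (P i))) z) \<le> real (size (P i)) * d ^ size (P i)"
        using zd d1 by (rule norm_pderiv_root_poly_le)
      also have "\<dots> \<le> real M * d ^ M"
        using PM dM d1 by (intro mult_mono) auto
      finally have 1: "norm (poly (pderiv (root_poly (P i))) z) \<le> real M * d ^ M" .
      have "norm ?s \<le> real (size (Q i)) * (1 / \<delta>)"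
      proof (rule norm_sum_mset_le)
        fix w assume "w \<in># Q i"
        then have "\<delta> \<le> norm (z - w)"
          using far[OF z] by (auto simp: Q_def)
        then show "norm (1 / (z - w)) \<le> 1 / \<delta>"
          using \<delta>(1) by (simp add: norm_divide frac_le)
      qed
      \<comment> \<open>The sum has at most \<open>n i\<close> terms; this growth is what the
        division by \<open>n i\<close> compensates.\<close>
      also have "\<dots> \<le> n i * (1 / \<delta>)"
      proof (rule mult_right_mono)
        have "size (Q i) \<le> size (proots (q i))"
          unfolding Q_def by (intro size_mset_mono) simp
        then show "real (size (Q i)) \<le> n i"
          by (simp add: size_proots_complex n_def)
      qed (use \<delta>(1) in simp)
      finally have 2: "norm ?s \<le> n i * (1 / \<delta>)" .
      have "norm (poly (root_poly (P i)) z) \<le> d ^ size (P i)"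
        using zd d1 by (intro norm_poly_root_poly_le) auto
      then have "norm (poly (root_poly (P i)) z) \<le> d ^ M"
        using dM by simp
      then have 3: "norm (poly (root_poly (P i)) z * ?s) \<le> d ^ M * (n i * (1 / \<delta>))"
        unfolding norm_mult using 2 d1 by (intro mult_mono) auto
      show ?thesis
        using norm_triangle_le[OF add_mono[OF 1 3]] n1[OF i]
        by (simp add: norm_divide divide_right_mono)
    qed
    also have "\<dots> = real M * d ^ M / n i + d ^ M * (1 / \<delta>)"
      using n1[OF i] by (simp add: add_divide_distrib)
    also have "real M * d ^ M / n i \<le> real M * d ^ M"
      using n1[OF i] d1 divide_left_mono[of 1 "n i" "real M * d ^ M"] by simp
    finally show ?thesis
      by simp
  qed
  have low: "1 / (2 * (S + 1)) \<le> norm (poly (root_poly (A i)) z0 * G i z0)" if i: "i \<in> I" for i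
  proof -
    let ?Q = "norm (poly (root_poly (Q i)) z0)"
    have "z0 \<in> U"
      using C(3) CU by auto
    then have Q0: "0 < ?Q"
      using Q_nz by simp
    have "1 ^ size (P i) \<le> norm (poly (root_poly (P i)) z0)"
    proof (rule norm_poly_root_poly_ge)
      fix w assume "w \<in># P i"
      then have "norm w < R"
        using norm_root[OF i] by (auto simp: P_def)
      then show "1 \<le> norm (z0 - w)"
        using norm_triangle_ineq2[of z0 w] norm_z0 S(2) by simp
    qed simp
    then have "n i / 2 * (norm (l i) * (1 * ?Q))
        \<le> n i / 2 * (norm (l i) * (norm (poly (root_poly (P i)) z0) * ?Q))"
      using n1[OF i] by (intro mult_left_mono mult_right_mono) auto
    also have "\<dots> = n i / 2 * norm (poly (q i) z0)"
      by (subst (1) q_eq[symmetric]) (simp add: norm_mult)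
    also have "\<dots> \<le> (S + 1) * norm (poly (pderiv (q i)) z0)"
      using norm_pderiv_ge_outside_roots[OF roots[OF i], of z0] norm_z0 S(2) by (simp add: n_def)
    finally have "n i * norm (l i) * ?Q \<le> 2 * (S + 1) * norm (poly (pderiv (q i)) z0)"
      by (simp add: algebra_simps)
    then show ?thesis
      unfolding F_eq using Q0 n1[OF i] l0[OF i] S(1)
      by (simp add: norm_divide norm_mult divide_simps mult_ac)
  qed
  have "\<exists>M. \<forall>i\<in>I. size (A i) \<le> M"
  proof (rule bounded_zero_count[OF U, of L' I G A])
    show "compact L'"
      unfolding L'_def using L(1) by (intro closed_Int_compact) auto
    show "L' \<subseteq> U" "z0 \<in> U"
      using C(3) CU by auto
    show "0 < 1 / (2 * (S + 1))"
      using S(1) by simp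
    show "G i holomorphic_on U" if "i \<in> I" for i
      unfolding G_def using Q_nz n1[OF that] l0[OF that] by (intro holomorphic_intros) auto
    show "set_mset (A i) \<subseteq> L'" for i
      by (auto simp: A_def)
  qed (fact bound low)+
  moreover have "A i = {#w \<in># proots (pderiv (q i)). w \<in> L#}" if i: "i \<in> I" for i
  proof -
    have "w \<in> cball 0 S" if "w \<in># proots (pderiv (q i))" for w
    proof -
      have "pderiv (q i) \<noteq> 0"
        using deg[OF i] by (simp add: pderiv_eq_0_iff)
      then have "w \<in> ball 0 R"
        using roots_pderiv_subset_ball[OF roots[OF i] deg[OF i]] that by auto
      then show ?thesis
        using S(2) by simp
    qed
    then show ?thesis
      unfolding A_def L'_def by (intro filter_mset_cong) auto
  qed
  ultimately show ?thesis
    by auto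
qed

lemma centers_on_pderiv:
  assumes K: "polynomially_convex K" and deg: "filterlim (\<lambda>k. degree (q k)) at_top sequentially"
    and q: "centers_on q K"
  shows "centers_on (\<lambda>k. pderiv (q k)) K"
proof -
  have cK: "compact K" "K \<noteq> {}"
    using q by (auto simp: centers_on_def)
  from q obtain N R where R: "0 < R"
    and roots: "\<forall>k\<ge>N. {z. poly (q k) z = 0} \<subseteq> ball 0 R"
    and count: "\<forall>L. closed L \<and> L \<inter> K = {} \<longrightarrow>
      (\<exists>M>0. \<forall>k\<ge>N. size {#z \<in># proots (q k). z \<in> L#} \<le> M)"
    unfolding centers_on_def by (elim conjE exE)
  \<comment> \<open>A constant polynomial has derivative 0, which vanishes everywhere, so such
    indices must be skipped.\<close>
  have "eventually (\<lambda>k. 0 < degree (q k)) sequentially"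
    using eventually_gt_at_top deg by (rule eventually_compose_filterlim)
  then obtain N1 where N1: "\<And>k. k \<ge> N1 \<Longrightarrow> 0 < degree (q k)"
    by (auto simp: eventually_sequentially)
  define N' where "N' = max N N1"
  have 1: "\<forall>k\<ge>N'. {z. poly (pderiv (q k)) z = 0} \<subseteq> ball 0 R"
    using roots_pderiv_subset_ball[OF roots[rule_format] N1] by (simp add: N'_def)
  have 2: "\<exists>M>0. \<forall>k\<ge>N'. size {#z \<in># proots (pderiv (q k)). z \<in> L#} \<le> M"
    if "closed L" "L \<inter> K = {}" for L
  proof -
    have "\<exists>M. \<forall>k\<in>{N'..}. size {#z \<in># proots (pderiv (q k)). z \<in> L#} \<le> M"
    proof (rule pderiv_root_count_bounded[OF cK(1) _ _ _ _ that])
      show "connected (- K)"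
        using K by (simp add: polynomially_convex_def)
      show "{w. poly (q k) w = 0} \<subseteq> ball 0 R" "0 < degree (q k)" if "k \<in> {N'..}" for k
        using that roots[rule_format, of k] N1[of k] by (simp_all add: N'_def)
      show "\<exists>M. \<forall>k\<in>{N'..}. size {#w \<in># proots (q k). w \<in> W#} \<le> M"
        if "closed W" "W \<inter> K = {}" for W
      proof -
        have "\<exists>M>0. \<forall>k\<ge>N. size {#w \<in># proots (q k). w \<in> W#} \<le> M"
          using count[THEN spec, of W] that by simp
        then obtain M where "\<forall>k\<ge>N. size {#w \<in># proots (q k). w \<in> W#} \<le> M"
          by auto
        then show ?thesis
          by (intro exI[of _ M]) (simp add: N'_def)
      qed
    qed
    then obtain M where "\<And>k. k \<ge> N' \<Longrightarrow> size {#z \<in># proots (pderiv (q k)). z \<in> L#} \<le> M"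
      by auto
    \<comment> \<open>The definition of centering asks for a positive bound, hence
      \<open>Suc M\<close>.\<close>
    then show ?thesis
      by (intro exI[of _ "Suc M"]) (auto intro: le_SucI)
  qed
  show ?thesis
    unfolding centers_on_def
    by (intro conjI exI[of _ N'] exI[of _ R] allI impI cK R 1 2) simp_all
qed

section \<open>Regularity of the derivatives\<close>

text \<open>All distances |z - w| lie between |z| / 2 and 2 |z|, so the mean of their logarithms
  differs from ln |z| by at most ln 2. Applied to one fixed polynomial, this controls the Green's
  function near infinity.\<close>

lemma ln_norm_poly_near_ln_norm:
  fixes p :: "complex poly"
  assumes roots: "{w. poly p w = 0} \<subseteq> ball 0 R" and R: "0 < R" "2 * R \<le> norm z"
    and deg: "0 < degree p"
  shows "\<bar>ln (norm (poly p z)) / degree p - ln (norm z)\<bar> \<le> \<bar>ln (norm (lead_coeff p))\<bar> / degree p + ln 2"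
proof -
  let ?n = "real (degree p)" and ?r = "norm (poly (root_poly (proots p)) z)"
  have p0: "p \<noteq> 0"
    using deg by auto
  have z: "0 < norm z"
    using R by linarith
  have near: "norm z / 2 \<le> norm (z - w)" "norm (z - w) \<le> 2 * norm z" if "w \<in># proots p" for w
  proof -
    have "norm w < R"
      using norm_proots_less[OF roots that] .
    then show "norm z / 2 \<le> norm (z - w)" "norm (z - w) \<le> 2 * norm z"
      using R norm_triangle_ineq2[of z w] norm_triangle_ineq4[of z w] by linarith+
  qed
  have le: "(norm z / 2) ^ degree p \<le> ?r" "?r \<le> (2 * norm z) ^ degree p"
    unfolding size_proots_complex[symmetric]
    by (rule norm_poly_root_poly_ge norm_poly_root_poly_le; use near in simp)+
  have r: "0 < ?r"
    by (rule less_le_trans[OF _ le(1)]) (use z in simp)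
  have "ln ((norm z / 2) ^ degree p) \<le> ln ?r" "ln ?r \<le> ln ((2 * norm z) ^ degree p)"
    using le r z by (auto intro: ln_mono)
  then have "?n * (ln (norm z) - ln 2) \<le> ln ?r" "ln ?r \<le> ?n * (ln (norm z) + ln 2)"
    using z by (simp_all add: ln_realpow ln_div ln_mult algebra_simps)
  then have "\<bar>ln ?r - ?n * ln (norm z)\<bar> \<le> ?n * ln 2"
    by (simp add: abs_le_iff algebra_simps)
  moreover have "ln (norm (poly p z)) = ln (norm (lead_coeff p)) + ln ?r"
  proof -
    have "norm (poly p z) = norm (lead_coeff p) * ?r"
      by (subst (1) smult_root_poly_proots[symmetric]) (simp add: norm_mult)
    then show ?thesis
      using r p0 by (simp add: ln_mult)
  qed
  ultimately have "\<bar>ln (norm (poly p z)) - ?n * ln (norm z)\<bar> \<le> \<bar>ln (norm (lead_coeff p))\<bar> + ?n * ln 2"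
    by linarith
  then have "\<bar>ln (norm (poly p z)) - ?n * ln (norm z)\<bar> / ?n \<le> (\<bar>ln (norm (lead_coeff p))\<bar> + ?n * ln 2) / ?n"
    by (rule divide_right_mono) simp
  moreover have "\<bar>ln (norm (poly p z)) - ?n * ln (norm z)\<bar> / ?n = \<bar>ln (norm (poly p z)) / ?n - ln (norm z)\<bar>"
  proof -
    have "ln (norm (poly p z)) / ?n - ln (norm z) = (ln (norm (poly p z)) - ?n * ln (norm z)) / ?n"
      using deg by (simp add: diff_divide_distrib)
    then show ?thesis
      by (simp add: abs_divide)
  qed
  ultimately show ?thesis
    using deg by (simp add: add_divide_distrib)
qed

lemma ln_norm_pderiv_near:
  fixes p :: "complex poly"
  assumes roots: "{w. poly p w = 0} \<subseteq> ball 0 R" and R: "0 < R" "2 * R \<le> norm z"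
    and deg: "0 < degree p"
  shows "poly (pderiv p) z \<noteq> 0"
    and "\<bar>ln (norm (poly (pderiv p) z)) - (ln (norm (poly p z)) + ln (degree p) - ln (norm z))\<bar> \<le> ln 2"
proof -
  let ?n = "real (degree p)"
  have z: "0 < norm z" "R \<le> norm z"
    using R by linarith+
  have p: "0 < norm (poly p z)"
    using roots z(2) by auto
  show p': "poly (pderiv p) z \<noteq> 0"
    using roots_pderiv_subset_ball[OF roots deg] z(2) by auto
  have "ln (?n / 2 * norm (poly p z)) \<le> ln (norm z * norm (poly (pderiv p) z))"
    using norm_pderiv_ge_outside_roots[OF roots z(2)] p deg by (intro ln_mono) auto
  moreover have "ln (norm z * norm (poly (pderiv p) z)) \<le> ln (2 * ?n * norm (poly p z))"
    using norm_pderiv_le_outside_roots[OF roots R] p' z(1) by (intro ln_mono) auto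
  ultimately show "\<bar>ln (norm (poly (pderiv p) z)) - (ln (norm (poly p z)) + ln ?n - ln (norm z))\<bar> \<le> ln 2"
    using p p' z(1) deg by (simp add: ln_mult ln_div abs_le_iff)
qed

text \<open>Passage from \<open>ereal\<close> to \<open>real\<close>: if \<open>x\<close> is not
  positive or \<open>g\<close> is infinite, the left-hand difference has absolute value
  \<open>\<infinity>\<close>, also for equal infinities.\<close>

lemma elog_div_near_iff:
  assumes "0 < n"
  shows "\<bar>elog x / ereal n - g\<bar> < ereal e \<longleftrightarrow>
    0 < x \<and> \<bar>g\<bar> \<noteq> \<infinity> \<and> \<bar>ln x / n - real_of_ereal g\<bar> < e"
  using assms by (cases g) (auto simp: elog_def)

text \<open>Up to an error of ln 2, ln |q'| - (n - 1) g equals (ln |q| - n g) + ln n + (g - ln |z|).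
  The last bracket is bounded near infinity, so only the first survives division by n - 1.\<close>

lemma K_regular_pderiv:
  assumes deg: "filterlim (\<lambda>k. degree (q k)) at_top sequentially" and q: "K_regular K q"
  shows "K_regular K (\<lambda>k. pderiv (q k))"
proof -
  from q obtain R where R: "0 < R" "K \<subseteq> ball 0 R"
    and reg: "\<And>\<epsilon>. 0 < \<epsilon> \<Longrightarrow> \<forall>\<^sub>F k in sequentially. \<forall>z\<in>- ball 0 R.
      \<bar>elog (cmod (poly (q k) z)) / ereal (real (degree (q k))) - green K z\<bar> < ereal \<epsilon>"
    by (auto simp: K_regular_def)
  define g where "g z = real_of_ereal (green K z)" for z
  define near where "near \<epsilon> k \<longleftrightarrow> 1 < degree (q k) \<and> {w. poly (q k) w = 0} \<subseteq> ball 0 R \<and>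
    (\<forall>z. R \<le> norm z \<longrightarrow> \<bar>green K z\<bar> \<noteq> \<infinity> \<and> \<bar>ln (norm (poly (q k) z)) / degree (q k) - g z\<bar> < \<epsilon>)" for \<epsilon> k
  have near: "eventually (near \<epsilon>) sequentially" if "0 < \<epsilon>" for \<epsilon>
  proof -
    have "eventually (\<lambda>k. 1 < degree (q k)) sequentially"
      using eventually_gt_at_top deg by (rule eventually_compose_filterlim)
    then show ?thesis
      using reg[OF that]
    proof eventually_elim
      case (elim k)
      have "0 < real (degree (q k))"
        using elim(1) by simp
      note iff = elog_div_near_iff[OF this]
      have *: "poly (q k) z \<noteq> 0 \<and> \<bar>green K z\<bar> \<noteq> \<infinity> \<and> \<bar>ln (norm (poly (q k) z)) / degree (q k) - g z\<bar> < \<epsilon>"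
        if "R \<le> norm z" for z
        using elim(2)[rule_format, of z] that unfolding iff by (simp add: g_def)
      then have "{w. poly (q k) w = 0} \<subseteq> ball 0 R"
        by (force simp: not_le[symmetric])
      then show ?case
        using elim(1) * by (simp add: near_def)
    qed
  qed
  \<comment> \<open>One sufficiently good polynomial shows that g - ln |z| is bounded; the final 1
    in \<open>B\<close> is its distance from \<open>g\<close>.\<close>
  obtain k0 where k0: "near 1 k0"
    using near[of 1] eventually_happens[of "near 1" sequentially] by auto
  define B where "B = \<bar>ln (norm (lead_coeff (q k0)))\<bar> / degree (q k0) + ln 2 + 1"
  have fin: "\<bar>green K z\<bar> \<noteq> \<infinity>" if "R \<le> norm z" for z
    using k0 that by (simp add: near_def)
  have B: "\<bar>g z - ln (norm z)\<bar> \<le> B" if z: "2 * R \<le> norm z" for z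
  proof -
    have "R \<le> norm z"
      using z R(1) by linarith
    then have "\<bar>ln (norm (poly (q k0) z)) / degree (q k0) - g z\<bar> < 1"
      using k0 by (simp add: near_def)
    moreover have "\<bar>ln (norm (poly (q k0) z)) / degree (q k0) - ln (norm z)\<bar> \<le> B - 1"
      using ln_norm_poly_near_ln_norm[of "q k0" R z] k0 R(1) z by (simp add: near_def B_def)
    ultimately show ?thesis
      by linarith
  qed
  \<comment> \<open>The radius is doubled because the upper bound for the derivative needs
    \<open>2 * R \<le> norm z\<close>.\<close>
  have "\<forall>\<^sub>F k in sequentially. \<forall>z\<in>- ball 0 (2 * R).
      \<bar>elog (cmod (poly (pderiv (q k)) z)) / ereal (real (degree (pderiv (q k)))) - green K z\<bar> < ereal \<epsilon>"
    if \<epsilon>: "0 < \<epsilon>" for \<epsilon>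
  proof -
    \<comment> \<open>This is the total error after normalization by n - 1. Starting from
      \<open>\<epsilon> / 2\<close> for \<open>q k\<close> leaves room for the remaining terms,
      which vanish in the limit.\<close>
    have "((\<lambda>n. (n * (\<epsilon> / 2) + ln 2 + ln n + B) / (n - 1)) \<longlongrightarrow> \<epsilon> / 2) at_top"
      using \<epsilon> by real_asymp
    then have "eventually (\<lambda>n. (n * (\<epsilon> / 2) + ln 2 + ln n + B) / (n - 1) < \<epsilon>) at_top"
      by (rule order_tendstoD) (use \<epsilon> in simp)
    moreover have "filterlim (\<lambda>k. real (degree (q k))) at_top sequentially"
      by (rule filterlim_compose[OF filterlim_real_sequentially deg])
    ultimately have "\<forall>\<^sub>F k in sequentially. (real (degree (q k)) * (\<epsilon> / 2) + ln 2 + ln (real (degree (q k))) + B)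
        / (real (degree (q k)) - 1) < \<epsilon>"
      by (rule eventually_compose_filterlim)
    moreover have "eventually (near (\<epsilon> / 2)) sequentially"
      using near \<epsilon> by simp
    ultimately show ?thesis
    proof eventually_elim
      case (elim k)
      define n where "n = real (degree (q k))"
      have n: "1 < n" "real (degree (pderiv (q k))) = n - 1"
        using elim(2) by (auto simp: near_def n_def degree_pderiv)
      show ?case
      proof
        fix z :: complex assume "z \<in> - ball 0 (2 * R)"
        then have z: "2 * R \<le> norm z" "R \<le> norm z"
          using R(1) by auto
        let ?a = "ln (norm (poly (q k) z))" and ?b = "ln (norm (poly (pderiv (q k)) z))"
        have nz: "poly (pderiv (q k)) z \<noteq> 0" and near': "\<bar>?b - (?a + ln n - ln (norm z))\<bar> \<le> ln 2"
          using ln_norm_pderiv_near[of "q k" R z] elim(2) R(1) z(1) by (auto simp: near_def n_def)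
        have "\<bar>?a / n - g z\<bar> < \<epsilon> / 2"
          using elim(2) z(2) by (simp add: near_def n_def)
        then have "n * \<bar>?a / n - g z\<bar> \<le> n * (\<epsilon> / 2)"
          using n(1) by (intro mult_left_mono) auto
        moreover have "n * \<bar>?a / n - g z\<bar> = \<bar>?a - n * g z\<bar>"
          using n(1) by (simp add: abs_mult_pos' right_diff_distrib)
        ultimately have "\<bar>?a - n * g z\<bar> \<le> n * (\<epsilon> / 2)"
          by simp
        moreover have "0 \<le> ln n"
          using n(1) by simp
        ultimately have "\<bar>?b - (n - 1) * g z\<bar> \<le> n * (\<epsilon> / 2) + ln 2 + ln n + B"
          using near' B[OF z(1)] unfolding left_diff_distrib by linarith
        then have "\<bar>?b - (n - 1) * g z\<bar> / (n - 1) \<le> (n * (\<epsilon> / 2) + ln 2 + ln n + B) / (n - 1)"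
          using n(1) by (intro divide_right_mono) auto
        also have "\<dots> < \<epsilon>"
          using elim(1) by (simp add: n_def)
        also have "\<bar>?b - (n - 1) * g z\<bar> / (n - 1) = \<bar>(?b - (n - 1) * g z) / (n - 1)\<bar>"
          using n(1) by (simp add: abs_divide)
        also have "(?b - (n - 1) * g z) / (n - 1) = ?b / (n - 1) - g z"
          using n(1) by (simp add: diff_divide_distrib)
        finally have "\<bar>?b / (n - 1) - g z\<bar> < \<epsilon>" .
        then show "\<bar>elog (cmod (poly (pderiv (q k)) z)) / ereal (real (degree (pderiv (q k)))) - green K z\<bar> < ereal \<epsilon>"
          using nz fin[OF z(2)] n by (simp add: elog_div_near_iff g_def)
      qed
    qed
  qed
  moreover have "0 < 2 * R" "K \<subseteq> ball 0 (2 * R)"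
    using R by auto
  ultimately show ?thesis
    unfolding K_regular_def by blast
qed

theorem theorem1:
  fixes K :: "complex set" and q :: "nat \<Rightarrow> complex poly"
  assumes "compact K" and "\<not> polar K" and "polynomially_convex K"
    and "filterlim (\<lambda>k. degree (q k)) at_top sequentially"
  shows "(K_regular K q \<longrightarrow> K_regular K (\<lambda>k. pderiv (q k))) \<and>
    (centers_on q K \<longrightarrow> centers_on (\<lambda>k. pderiv (q k)) K)"
  using K_regular_pderiv centers_on_pderiv assms(3,4) by blast

end
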